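(* Let $m$ be a complex number and let $x$ be an indeterminate. The sequence of Tanny-Dowling polynomials $\mathcal{F}_m(n,x)=\sum_{k=0}^n k!\,W_m(n,k)x^k$, $n\ge 0$, is the moment sequence of a family of orthogonal polynomials over the field $\mathbb{C}(x)$.
   Context: The Whitney numbers of the second kind of Dowling lattices are $W_m(n,k)=\sum_{i=k}^n\binom{n}{i}m^{i-k}S(i,k)$ (with $0^0=1$), where $S(i,k)$ are the Stirling numbers of the second kind; for $m\ne 0$ this is equivalent to $\sum_{n\ge 0} W_m(n,k)\frac{z^n}{n!}=\frac{e^z}{m^k k!}(e^{mz}-1)^k$, and $W_0(n,k)=\binom{n}{k}$. Orthogonality is meant in the formal (algebraic) sense. Let $K=\mathbb{C}(x)$. A family of orthogonal polynomials over $K$ is a sequence $(P_n(z))_{n\ge 0}$ of monic polynomials in $K[z]$ with $\deg P_n=n$ for which there is a $K$-linear functional $\mathcal{L}:K[z]\to K$ with $\mathcal{L}(1)=1$, $\mathcal{L}(P_iP_j)=0$ for all $i\ne j$, and $\mathcal{L}(P_n^2)\neq 0$ for all $n$. Its moment sequence is $(\mathcal{L}(z^n))_{n\ge 0}$. *)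

theory Defs
  imports
    Complex_Main
    "HOL-Computational_Algebra.Polynomial"
    "HOL-Computational_Algebra.Polynomial_Factorial"
    "HOL-Combinatorics.Stirling"
begin

definition dowling_whitney2 :: "complex \<Rightarrow> nat \<Rightarrow> nat \<Rightarrow> complex" where
  "dowling_whitney2 m n k =
     (\<Sum>i = k..n. of_nat (n choose i) * m ^ (i - k) * of_nat (Stirling i k))"

definition tanny_dowling :: "complex \<Rightarrow> nat \<Rightarrow> complex poly" where
  "tanny_dowling m n = (\<Sum>k\<le>n. monom (fact k * dowling_whitney2 m n k) k)"

definition orthogonal_wrt ::
    "('a::field poly \<Rightarrow> 'a) \<Rightarrow> (nat \<Rightarrow> 'a poly) \<Rightarrow> bool" where
  "orthogonal_wrt L P \<longleftrightarrow>
     (\<forall>n. lead_coeff (P n) = 1 \<and> degree (P n) = n) \<and>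
     Vector_Spaces.linear smult (*) L \<and>
     L 1 = 1 \<and>
     (\<forall>i j. i \<noteq> j \<longrightarrow> L (P i * P j) = 0) \<and>
     (\<forall>n. L (P n ^ 2) \<noteq> 0)"

definition moment_seq_of_orthogonal_polys :: "(nat \<Rightarrow> 'a::field) \<Rightarrow> bool" where
  "moment_seq_of_orthogonal_polys \<mu> \<longleftrightarrow>
     (\<exists>P L. orthogonal_wrt L P \<and> (\<forall>n. \<mu> n = L (monom 1 n)))"

end

theory Submission
  imports Defs "HOL-Computational_Algebra.Formal_Power_Series"
begin

text \<open>
  Put \<open>q\<^sub>k(z) = (z - 1)(z - 1 - m) \<dots> (z - 1 - (k-1)m)\<close>. Substituting \<open>w = z - 1\<close> in the Stirling
  expansion of \<open>w^n\<close> gives \<open>z^n = \<Sum>k\<le>n. W\<^sub>m(n,k) q\<^sub>k(z)\<close>, so the moment functional of the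
  Tanny-Dowling polynomials is the one with \<open>L(q\<^sub>k) = k! x^k\<close>. For the opposite products
  \<open>r\<^sub>j(z) = (z - 1 + m) \<dots> (z - 1 + jm)\<close> one finds \<open>L(q\<^sub>k r\<^sub>j) = (k+j)! x^k (x+m)^j\<close>. Pairing the
  (affinely rescaled) Meixner polynomial, Laguerre if \<open>m = 0\<close>, with \<open>r\<^sub>j\<close> hence produces an \<open>n\<close>-th
  finite difference of a polynomial of degree \<open>j\<close>: it vanishes for \<open>j < n\<close> and is
  \<open>n!\<^sup>2 x^n (x+m)^n \<noteq> 0\<close> for \<open>j = n\<close>.
\<close>

text \<open>Factorials are inverted and generalized binomial coefficients are used below, so the
  fraction field has to be known to have characteristic zero.\<close>

instance fract :: ("{idom, ring_char_0}") ring_char_0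
  by standard (auto simp: of_nat_fract eq_fract inj_on_def)

instance fract :: ("{idom, ring_char_0}") field_char_0 ..

text \<open>This is the classical expansion of a power in falling factorials, homogenised so that
  nothing is divided by \<open>m\<close>; at \<open>m = 0\<close> only \<open>k = n\<close>
  survives. The induction matches \<open>q k * w = q (Suc k) + m * of_nat k * q k\<close> with the
  Stirling recurrence.\<close>

lemma power_eq_sum_Stirling:
  fixes m w :: "'a::comm_ring_1"
  shows "w ^ n = (\<Sum>k\<le>n. m ^ (n - k) * of_nat (Stirling n k) * (\<Prod>l<k. w - m * of_nat l))"
proof (induction n)
  case 0
  show ?case by simp
next
  case (Suc n)
  define q where "q k = (\<Prod>l<k. w - m * of_nat l)" for k
  define s where "s n k = m ^ (n - k) * of_nat (Stirling n k)" for n k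
  have q_mult: "q k * w = q (Suc k) + m * of_nat k * q k" for k
    by (simp add: q_def algebra_simps)
  have s_Suc: "s (Suc n) (Suc k) = s n k + m * of_nat (Suc k) * s n (Suc k)" for k
  \<comment> \<open>The exponent \<open>n - Suc k\<close> is truncated when
    \<open>n \<le> k\<close>, but then \<open>Stirling n (Suc k) = 0\<close>.\<close>
  proof (cases "k < n")
    case True
    then have "m ^ (n - k) = m * m ^ (n - Suc k)"
      by (simp add: Suc_diff_Suc flip: power_Suc)
    then show ?thesis by (simp add: s_def algebra_simps)
  qed (simp add: s_def)
  have "w ^ Suc n = (\<Sum>k\<le>n. s n k * (q k * w))"
    using Suc.IH by (simp add: s_def q_def sum_distrib_left mult_ac)
  also have "\<dots> = (\<Sum>k\<le>n. s n k * q (Suc k)) + (\<Sum>k\<le>n. m * of_nat k * s n k * q k)"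
    unfolding q_mult distrib_left sum.distrib by (simp only: mult_ac)
  \<comment> \<open>The new top term vanishes because \<open>Stirling n (Suc n) = 0\<close>; the
    bottom term, dropped next, vanishes through \<open>of_nat k\<close>. Both sums then run over
    \<open>q (Suc k)\<close>.\<close>
  also have "(\<Sum>k\<le>n. m * of_nat k * s n k * q k) = (\<Sum>k\<le>Suc n. m * of_nat k * s n k * q k)"
    by (simp add: s_def)
  also have "\<dots> = (\<Sum>k\<le>n. m * of_nat (Suc k) * s n (Suc k) * q (Suc k))"
    by (subst sum.atMost_Suc_shift) simp
  also have "(\<Sum>k\<le>n. s n k * q (Suc k)) + \<dots> = (\<Sum>k\<le>n. s (Suc n) (Suc k) * q (Suc k))"
    by (simp only: s_Suc distrib_right sum.distrib)
  also have "\<dots> = (\<Sum>k\<le>Suc n. s (Suc n) k * q k)"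
    by (subst sum.atMost_Suc_shift) (simp add: s_def)
  finally show ?case by (simp only: s_def q_def)
qed

text \<open>Upper negation turns \<open>(-1)^k * ((k + j) choose k)\<close> into
  \<open>-(j + 1) gchoose k\<close>, which leaves a Vandermonde convolution.\<close>

lemma alternating_sum_binomial_shifted:
  fixes n j :: nat
  shows "(\<Sum>k\<le>n. (- 1) ^ k * of_nat (n choose k) * of_nat ((k + j) choose k))
         = ((of_nat n - of_nat j - 1) gchoose n :: 'a::field_char_0)"
proof -
  have "(\<Sum>k\<le>n. (- 1) ^ k * of_nat (n choose k) * of_nat ((k + j) choose k))
        = (\<Sum>k\<in>{0..n}. (- (of_nat j + 1) gchoose k) * (of_nat n gchoose (n - k)) :: 'a)"
  proof (rule sum.cong)
    fix k assume "k \<in> {0..n}"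
    then have "(of_nat n gchoose (n - k) :: 'a) = of_nat (n choose k)"
      by (simp add: binomial_gbinomial[symmetric] binomial_symmetric[symmetric])
    moreover have "(- (of_nat j + 1) gchoose k :: 'a) = (- 1) ^ k * of_nat ((k + j) choose k)"
      by (simp only: gbinomial_minus binomial_gbinomial) (simp add: add.commute)
    ultimately show "(- 1) ^ k * of_nat (n choose k) * of_nat ((k + j) choose k)
        = (- (of_nat j + 1) gchoose k) * (of_nat n gchoose (n - k) :: 'a)"
      by simp
  qed auto
  also have "\<dots> = (of_nat n - of_nat j - 1) gchoose n"
    by (simp only: gbinomial_Vandermonde) (simp add: algebra_simps)
  finally show ?thesis .
qed

section \<open>Falling and rising bases and the rescaled Meixner polynomials\<close>

definition falling_poly :: "'a::comm_ring_1 \<Rightarrow> nat \<Rightarrow> 'a poly" where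
  "falling_poly m k = (\<Prod>l<k. [:- 1 - m * of_nat l, 1:])"

text \<open>Starting at \<open>Suc 0\<close> skips the factor \<open>z - 1\<close>, so that the
  factors of \<open>falling_poly m k * rising_poly m j\<close> form an arithmetic progression
  without gap or repetition.\<close>

definition rising_poly :: "'a::comm_ring_1 \<Rightarrow> nat \<Rightarrow> 'a poly" where
  "rising_poly m j = (\<Prod>l<j. [:m * of_nat (Suc l) - 1, 1:])"

text \<open>For nonzero \<open>m\<close>, \<open>x\<close> and \<open>x + m\<close> this is
  \<open>n! (-x)^n M_n((z - 1)/m; 1, x/(x + m))\<close> with \<open>M_n\<close> the Meixner
  polynomial; for \<open>m = 0\<close> and nonzero \<open>x\<close> it is
  \<open>n! (-x)^n L_n((z - 1)/x)\<close> with \<open>L_n\<close> the Laguerre polynomial. Expanding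
  in \<open>falling_poly\<close> treats both cases at once.\<close>

definition meixner_poly :: "'a::field_char_0 \<Rightarrow> 'a \<Rightarrow> nat \<Rightarrow> 'a poly" where
  "meixner_poly m x n =
     (\<Sum>k\<le>n. smult ((- x) ^ (n - k) * of_nat (n choose k) * (fact n / fact k)) (falling_poly m k))"

lemma monic_prod_linear:
  fixes c :: "nat \<Rightarrow> 'a::idom"
  shows "degree (\<Prod>l<k. [:c l, 1:]) = k" and "lead_coeff (\<Prod>l<k. [:c l, 1:]) = 1"
proof -
  show "degree (\<Prod>l<k. [:c l, 1:]) = k"
    by (subst degree_prod_sum_eq) auto
  show "lead_coeff (\<Prod>l<k. [:c l, 1:]) = 1"
    by (simp add: lead_coeff_prod)
qed

lemma degree_falling_poly [simp]: "degree (falling_poly (m :: 'a::idom) k) = k"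
  and lead_coeff_falling_poly: "coeff (falling_poly (m :: 'a::idom) k) k = 1"
  using monic_prod_linear[of "\<lambda>l. - 1 - m * of_nat l" k] by (simp_all add: falling_poly_def)

lemma degree_rising_poly [simp]: "degree (rising_poly (m :: 'a::idom) k) = k"
  and lead_coeff_rising_poly: "coeff (rising_poly (m :: 'a::idom) k) k = 1"
  using monic_prod_linear[of "\<lambda>l. m * of_nat (Suc l) - 1" k] by (simp_all add: rising_poly_def)

lemma coeff_meixner_poly_self: "coeff (meixner_poly m x n) n = 1"
proof -
  have "coeff (meixner_poly m x n) n
        = (\<Sum>k\<le>n. (- x) ^ (n - k) * of_nat (n choose k) * (fact n / fact k) * coeff (falling_poly m k) n)"
    by (simp add: meixner_poly_def coeff_sum)
  also have "\<dots> = (\<Sum>k\<in>{n}. (- x) ^ (n - k) * of_nat (n choose k) * (fact n / fact k) * coeff (falling_poly m k) n)"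
    by (rule sum.mono_neutral_right) (auto simp: coeff_eq_0)
  finally show ?thesis by (simp add: lead_coeff_falling_poly)
qed

lemma degree_meixner_poly: "degree (meixner_poly m x n) = n"
proof (rule antisym)
  show "degree (meixner_poly m x n) \<le> n"
    unfolding meixner_poly_def by (rule degree_sum_le) (auto intro: order_trans[OF degree_smult_le])
  show "n \<le> degree (meixner_poly m x n)"
    by (rule le_degree) (simp add: coeff_meixner_poly_self)
qed

text \<open>The coefficients are the Whitney numbers, spelled out because
  \<open>dowling_whitney2\<close> is fixed to complex \<open>m\<close> while the expansion is needed
  over the fraction field. They arise from \<open>(w + 1)^n\<close> by expanding each
  \<open>w^i\<close> with the constant polynomial \<open>[:m:]\<close> as parameter and exchanging
  the sums.\<close>

lemma monom_eq_sum_falling_poly: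
  fixes m :: "'a::comm_ring_1"
  shows "monom 1 n = (\<Sum>k\<le>n. smult (\<Sum>i=k..n. of_nat (n choose i) * m ^ (i - k) * of_nat (Stirling i k))
                                     (falling_poly m k))"
proof -
  define w :: "'a poly" where "w = [:- 1, 1:]"
  have falling: "falling_poly m k = (\<Prod>l<k. w - [:m:] * of_nat l)" for k
    unfolding falling_poly_def w_def by (intro prod.cong) (simp_all add: of_nat_poly)
  have "monom 1 n = (w + 1) ^ n"
    by (simp add: w_def monom_altdef one_pCons)
  also have "\<dots> = (\<Sum>i\<le>n. of_nat (n choose i) * w ^ i)"
    by (simp add: binomial_ring)
  also have "\<dots> = (\<Sum>i\<le>n. \<Sum>k\<le>i. of_nat (n choose i) * ([:m:] ^ (i - k) * of_nat (Stirling i k) * falling_poly m k))"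
    by (subst power_eq_sum_Stirling[of w _ "[:m:]"]) (simp add: sum_distrib_left falling)
  also have "\<dots> = (\<Sum>i\<le>n. \<Sum>k\<le>i. smult (of_nat (n choose i) * m ^ (i - k) * of_nat (Stirling i k)) (falling_poly m k))"
    by (simp add: of_nat_poly poly_const_pow mult_ac)
  also have "\<dots> = (\<Sum>k\<le>n. \<Sum>i=k..n. smult (of_nat (n choose i) * m ^ (i - k) * of_nat (Stirling i k)) (falling_poly m k))"
    unfolding sum.Sigma[OF finite_atMost ballI[OF finite_atMost]]
      sum.Sigma[OF finite_atMost ballI[OF finite_atLeastAtMost]]
    by (rule sum.reindex_bij_witness[of _ "\<lambda>(a, b). (b, a)" "\<lambda>(a, b). (b, a)"]) auto
  finally show ?thesis by (simp add: smult_sum)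
qed

text \<open>The monomials are a basis, so a linear functional may take arbitrary values on
  them.\<close>

lemma ex_functional_with_moments:
  fixes \<mu> :: "nat \<Rightarrow> 'a::field"
  obtains L :: "'a poly \<Rightarrow> 'a"
  where "Vector_Spaces.linear smult (*) L" and "\<And>n. L (monom 1 n) = \<mu> n"
proof
  define L where "L p = (\<Sum>i\<le>degree p. coeff p i * \<mu> i)" for p
  \<comment> \<open>Padding with zero coefficients allows polynomials of different degrees to be
    summed over one range.\<close>
  have L_eq: "L p = (\<Sum>i\<le>N. coeff p i * \<mu> i)" if "degree p \<le> N" for p N
    unfolding L_def using that by (intro sum.mono_neutral_left) (auto simp: coeff_eq_0)
  have "L (p + q) = L p + L q" for p q
  proof -
    define N where "N = max (degree p) (degree q)"
    have "degree (p + q) \<le> N" "degree p \<le> N" "degree q \<le> N"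
      by (auto simp: N_def degree_add_le_max)
    then show ?thesis
      by (simp add: L_eq[of _ N] sum.distrib algebra_simps)
  qed
  moreover have "L (smult c p) = c * L p" for c p
    using L_eq[of "smult c p" "degree p"]
    by (simp add: L_def[of p] degree_smult_le sum_distrib_left mult.assoc)
  moreover have "vector_space (smult :: 'a \<Rightarrow> 'a poly \<Rightarrow> 'a poly)"
    by unfold_locales (simp_all add: smult_add_right smult_add_left)
  moreover have "vector_space ((*) :: 'a \<Rightarrow> 'a \<Rightarrow> 'a)"
    by unfold_locales (simp_all add: algebra_simps)
  ultimately show "Vector_Spaces.linear smult (*) L"
    by (simp add: Vector_Spaces.linear_iff)
  show "L (monom 1 n) = \<mu> n" for n
    by (subst L_eq[of _ n]) (simp_all add: degree_monom_le if_distribR if_distrib[of "\<lambda>c. c * _"] cong: if_cong)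
qed

section \<open>Orthogonality from the values on the falling basis\<close>

locale tanny_dowling_functional = L: Vector_Spaces.linear smult "(*)" L
  for L :: "'a::field_char_0 poly \<Rightarrow> 'a" +
  fixes m x :: 'a
  assumes L_falling: "L (falling_poly m k) = fact k * x ^ k"
    and nonzero: "x \<noteq> 0" "x + m \<noteq> 0"
begin

text \<open>The last factor of \<open>rising_poly m (Suc j)\<close> is the next factor of the
  falling product plus the constant \<open>m * of_nat (Suc (k + j))\<close>. The induction
  hypothesis at \<open>Suc k\<close> and at \<open>k\<close> then contributes the summands
  \<open>x\<close> and \<open>m\<close> of the new factor \<open>x + m\<close>, which is why
  \<open>k\<close> is arbitrary.\<close>

lemma L_falling_rising:
  "L (falling_poly m k * rising_poly m j) = fact (k + j) * x ^ k * (x + m) ^ j"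
proof (induction j arbitrary: k)
  case 0
  show ?case by (simp add: rising_poly_def L_falling)
next
  case (Suc j)
  let ?q = "\<lambda>k. falling_poly m k * rising_poly m j"
  have "[:m * of_nat (Suc j) - 1, 1:] = [:- 1 - m * of_nat k, 1:] + [:m * of_nat (Suc (k + j)):]"
    by (simp add: algebra_simps)
  then have "falling_poly m k * rising_poly m (Suc j)
        = ?q k * ([:- 1 - m * of_nat k, 1:] + [:m * of_nat (Suc (k + j)):])"
    by (simp only: rising_poly_def prod.lessThan_Suc mult.assoc)
  also have "\<dots> = ?q k * [:- 1 - m * of_nat k, 1:] + smult (m * of_nat (Suc (k + j))) (?q k)"
    by (simp only: distrib_left mult_pCons_right mult_zero_right pCons_0_0 add_0_right)
  also have "?q k * [:- 1 - m * of_nat k, 1:] = ?q (Suc k)"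
    by (simp only: falling_poly_def prod.lessThan_Suc mult_ac)
  finally have "falling_poly m k * rising_poly m (Suc j)
        = ?q (Suc k) + smult (m * of_nat (Suc (k + j))) (?q k)" .
  then have "L (falling_poly m k * rising_poly m (Suc j)) = L (?q (Suc k)) + m * of_nat (Suc (k + j)) * L (?q k)"
    by (simp only: L.add L.scale)
  also have "\<dots> = fact (k + Suc j) * x ^ k * (x + m) ^ Suc j"
  proof -
    have fact: "fact (Suc (k + j)) = (of_nat (Suc (k + j)) * fact (k + j) :: 'a)"
      by (rule fact_Suc)
    show ?thesis
      unfolding Suc.IH add_Suc add_Suc_right fact power_Suc by (simp only: distrib_left distrib_right mult_ac)
  qed
  finally show ?case .
qed

lemma L_meixner_rising:
  "L (meixner_poly m x n * rising_poly m j)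
     = (- x) ^ n * (x + m) ^ j * fact n * fact j * ((of_nat n - of_nat j - 1) gchoose n)"
proof -
  have "L (meixner_poly m x n * rising_poly m j)
        = (\<Sum>k\<le>n. (- x) ^ (n - k) * of_nat (n choose k) * (fact n / fact k)
                    * (fact (k + j) * x ^ k * (x + m) ^ j))"
    by (simp only: meixner_poly_def sum_distrib_right mult_smult_left L.sum L.scale L_falling_rising)
  also have "\<dots> = (\<Sum>k\<le>n. (- x) ^ n * (x + m) ^ j * fact n * fact j
                    * ((- 1) ^ k * of_nat (n choose k) * of_nat ((k + j) choose k)))"
  proof (rule sum.cong)
    fix k assume "k \<in> {..n}"
    \<comment> \<open>Writing \<open>x ^ k\<close> as \<open>(- x) ^ k * (- 1) ^ k\<close> frees the
      power of \<open>- x\<close> from \<open>k\<close> and leaves the alternating sign.\<close>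
    then have "(- x) ^ n = (- x) ^ (n - k) * (- x) ^ k"
      by (simp flip: power_add)
    then have "(- x) ^ n * (- 1) ^ k = (- x) ^ (n - k) * ((- x) ^ k * (- 1) ^ k)"
      by (simp only: mult.assoc)
    also have "(- x) ^ k * (- 1) ^ k = x ^ k"
      by (simp flip: power_mult_distrib)
    finally have x: "(- x) ^ (n - k) * x ^ k = (- x) ^ n * (- 1) ^ k" ..
    have "fact (k + j) / fact k = (fact j * of_nat ((k + j) choose k) :: 'a)"
      by (simp add: binomial_fact)
    then have "((- x) ^ (n - k) * x ^ k) * (fact (k + j) / fact k) * (of_nat (n choose k) * fact n * (x + m) ^ j)
       = ((- x) ^ n * (- 1) ^ k) * (fact j * of_nat ((k + j) choose k)) * (of_nat (n choose k) * fact n * (x + m) ^ j)"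
      by (simp only: x)
    then show "(- x) ^ (n - k) * of_nat (n choose k) * (fact n / fact k) * (fact (k + j) * x ^ k * (x + m) ^ j)
       = (- x) ^ n * (x + m) ^ j * fact n * fact j * ((- 1) ^ k * of_nat (n choose k) * of_nat ((k + j) choose k))"
      by (simp only: divide_inverse mult_ac)
  qed simp
  also have "\<dots> = (- x) ^ n * (x + m) ^ j * fact n * fact j * ((of_nat n - of_nat j - 1) gchoose n)"
    by (simp only: alternating_sum_binomial_shifted flip: sum_distrib_left)
  finally show ?thesis .
qed

text \<open>For \<open>j < n\<close> the upper argument of the binomial is the natural number
  \<open>n - j - 1\<close>, which is smaller than \<open>n\<close>.\<close>

lemma L_meixner_rising_eq_0:
  assumes "j < n"
  shows "L (meixner_poly m x n * rising_poly m j) = 0"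
proof -
  have "(of_nat n - of_nat j - 1 :: 'a) = of_nat (n - j - 1)"
    using assms by (simp add: of_nat_diff)
  then have "((of_nat n - of_nat j - 1) gchoose n :: 'a) = of_nat ((n - j - 1) choose n)"
    by (simp only: binomial_gbinomial)
  also have "\<dots> = 0"
    using assms by simp
  finally show ?thesis
    by (simp add: L_meixner_rising)
qed

text \<open>The rising products are monic with one in each degree; subtracting a multiple of one of
  them lowers the degree of \<open>f\<close>.\<close>

lemma L_meixner_lower:
  "degree f < n \<Longrightarrow> L (meixner_poly m x n * f) = 0"
proof (induction "degree f" arbitrary: f rule: less_induct)
  case less
  define d where "d = degree f"
  define g where "g = f - smult (lead_coeff f) (rising_poly m d)"
  have f: "f = g + smult (lead_coeff f) (rising_poly m d)"
    by (simp add: g_def)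
  have "degree g \<le> d"
    unfolding g_def by (rule degree_diff_le) (auto simp: d_def intro: order_trans[OF degree_smult_le])
  moreover have "coeff g d = 0"
    by (simp add: g_def d_def lead_coeff_rising_poly)
  \<comment> \<open>The zero polynomial has degree 0, so \<open>g = 0\<close> must be kept apart
    when \<open>d = 0\<close>.\<close>
  ultimately have "g = 0 \<or> degree g < d"
    using leading_coeff_0_iff[of g] by (cases "degree g = d") auto
  then have "L (meixner_poly m x n * g) = 0"
    using less.hyps[of g] less.prems d_def L.zero by fastforce
  moreover have "L (meixner_poly m x n * rising_poly m d) = 0"
    using less.prems by (intro L_meixner_rising_eq_0) (simp add: d_def)
  ultimately show ?case
    by (subst f) (simp add: distrib_left L.add L.scale)
qed

text \<open>One factor may be replaced by \<open>rising_poly m n\<close>, since two monic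
  polynomials of degree \<open>n\<close> differ by lower terms. The sign
  \<open>- 1 gchoose n\<close> cancels that of \<open>(- x) ^ n\<close>, and \<open>x\<close> and
  \<open>x + m\<close> are nonzero.\<close>

lemma L_meixner_square: "L (meixner_poly m x n ^ 2) \<noteq> 0"
proof -
  define g where "g = meixner_poly m x n - rising_poly m n"
  have "degree g \<le> n"
    unfolding g_def by (rule degree_diff_le) (auto simp: degree_meixner_poly)
  moreover have "coeff g n = 0"
    by (simp add: g_def coeff_meixner_poly_self lead_coeff_rising_poly)
  ultimately have "g = 0 \<or> degree g < n"
    using leading_coeff_0_iff[of g] by (cases "degree g = n") auto
  then have "L (meixner_poly m x n * g) = 0"
    by (auto simp: L_meixner_lower L.zero)
  moreover have "meixner_poly m x n ^ 2 = meixner_poly m x n * rising_poly m n + meixner_poly m x n * g"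
    by (simp add: g_def power2_eq_square algebra_simps)
  ultimately have "L (meixner_poly m x n ^ 2) = L (meixner_poly m x n * rising_poly m n)"
    by (simp add: L.add)
  moreover have "(- 1 gchoose n :: 'a) = (- 1) ^ n"
    using gbinomial_minus[of "1 :: 'a" n] binomial_gbinomial[of n n, where 'a = 'a] by simp
  ultimately show ?thesis
    using nonzero by (simp add: L_meixner_rising)
qed

lemma orthogonal_meixner_poly: "orthogonal_wrt L (meixner_poly m x)"
proof -
  have "L (meixner_poly m x i * meixner_poly m x j) = 0" if "i \<noteq> j" for i j
    using that L_meixner_lower[of "meixner_poly m x j" i] L_meixner_lower[of "meixner_poly m x i" j]
    by (cases i j rule: linorder_cases) (simp_all add: degree_meixner_poly mult.commute)
  moreover have "L 1 = 1"
    using L_falling[of 0] by (simp add: falling_poly_def)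
  ultimately show ?thesis
    unfolding orthogonal_wrt_def
    by (simp add: degree_meixner_poly coeff_meixner_poly_self L_meixner_square L.linear_axioms)
qed

end

section \<open>Transfer to the field of rational functions\<close>

lemma to_fract_of_nat [simp]: "to_fract (of_nat n) = of_nat n"
  by (induction n) simp_all

lemma to_fract_power [simp]: "to_fract (a ^ n) = to_fract a ^ n"
  by (induction n) simp_all

lemma to_fract_dowling_whitney2:
  "to_fract [:dowling_whitney2 m n k:]
     = (\<Sum>i=k..n. of_nat (n choose i) * to_fract [:m:] ^ (i - k) * of_nat (Stirling i k))"
proof -
  have "[:dowling_whitney2 m n k:]
      = (\<Sum>i=k..n. of_nat (n choose i) * [:m:] ^ (i - k) * of_nat (Stirling i k))"
    unfolding dowling_whitney2_def
    by (simp add: of_nat_poly poly_const_pow mult_ac flip: sum_to_poly)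
  then show ?thesis by simp
qed

lemma to_fract_tanny_dowling:
  "to_fract (tanny_dowling m n)
     = (\<Sum>k\<le>n. to_fract [:dowling_whitney2 m n k:] * (fact k * to_fract [:0, 1:] ^ k))"
proof -
  have "tanny_dowling m n = (\<Sum>k\<le>n. [:dowling_whitney2 m n k:] * (of_nat (fact k) * [:0, 1:] ^ k))"
    unfolding tanny_dowling_def
    by (intro sum.cong) (simp_all add: monom_altdef of_nat_poly mult.commute)
  then show ?thesis
    by (simp only: to_fract_sum to_fract_mult to_fract_power to_fract_of_nat) (simp only: of_nat_fact)
qed

theorem proposition5:
  fixes m :: complex
  shows "moment_seq_of_orthogonal_polys
           (\<lambda>n. to_fract (tanny_dowling m n) :: complex poly fract)"
proof -
  define X where "X = to_fract [:0, 1 :: complex:]"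
  define M where "M = to_fract [:m:]"
  define W where "W n k = to_fract [:dowling_whitney2 m n k:]" for n k
  obtain L where L: "Vector_Spaces.linear smult (*) L"
    and moments: "\<And>n. L (monom 1 n) = to_fract (tanny_dowling m n)"
    by (rule ex_functional_with_moments[of "\<lambda>n. to_fract (tanny_dowling m n)"]) blast
  interpret L: Vector_Spaces.linear smult "(*)" L
    by (rule L)
  \<comment> \<open>The functional is prescribed on monomials only. Its values on the falling basis
    follow because the Whitney numbers are unitriangular: two expansions of the \<open>n\<close>-th
    moment agree below \<open>n\<close> by induction, and \<open>W n n = 1\<close>.\<close>
  have "L (falling_poly M k) = fact k * X ^ k" for k
  proof (induction k rule: less_induct)
    case (less n)
    have "(\<Sum>k\<le>n. W n k * L (falling_poly M k)) = L (monom 1 n)"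
      by (simp only: monom_eq_sum_falling_poly[of n M] L.sum L.scale W_def M_def to_fract_dowling_whitney2)
    also have "\<dots> = (\<Sum>k\<le>n. W n k * (fact k * X ^ k))"
      by (simp only: moments to_fract_tanny_dowling W_def X_def)
    finally have "W n n * L (falling_poly M n) = W n n * (fact n * X ^ n)"
      using less by (simp flip: lessThan_Suc_atMost)
    moreover have "W n n = 1"
      by (simp add: W_def to_fract_dowling_whitney2)
    ultimately show ?case by simp
  qed
  \<comment> \<open>Here \<open>x\<close> being an indeterminate matters: \<open>x\<close> and
    \<open>x + m\<close> are nonzero polynomials for every complex \<open>m\<close>.\<close>
  moreover have "X \<noteq> 0" and "X + M \<noteq> 0"
    by (simp_all add: X_def M_def flip: to_fract_add)
  ultimately interpret tanny_dowling_functional L M X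
    by unfold_locales
  show ?thesis
    unfolding moment_seq_of_orthogonal_polys_def
    using orthogonal_meixner_poly moments by metis
qed

end
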